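(* Let $u_0\in\mathcal M$, let $u$ be the solution of $\partial_tu=-\Pi_uP(\mathcal B)u$, $u(0)=u_0$, and write $p_j=P(\lambda_j)$, $c_j=\langle u_0,e_j\rangle_H$. Then $$\langle u(t),e_j\rangle_H=\frac{e^{-p_jt}c_j}{\left(\sum_{k=1}^\infty e^{-2p_kt}|c_k|^2\right)^{1/2}},\qquad j\ge1,\ t\ge0 .$$ Consequently, for every $j\ge1$ and $t\ge0$, $\langle u(t),e_j\rangle_H=0$ if and only if $c_j=0$, and $$\Sigma_P(u(t))=\Sigma_P(u_0),\qquad t\ge0 .$$ Moreover, for every $\mu\in\sigma(P(\mathcal B))$ and $t\ge0$, $$\mathsf E_\mu u(t)=\frac{e^{-\mu t}}{\|S_P(t)u_0\|_H}\,\mathsf E_\mu u_0 .$$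
   Context: Let $d\ge1$, let $\Omega\subset\mathbb R^d$ be a bounded connected domain with $C^\infty$ boundary, and let $H=L^2(\Omega)$ (real) with its usual inner product $\langle\cdot,\cdot\rangle_H$ and norm $\|\cdot\|_H$. Let $\mathcal B=-\Delta_D$ be the positive Dirichlet Laplacian, $\mathcal D(\mathcal B)=H^2(\Omega)\cap H^1_0(\Omega)$, with eigenvalues $0<\lambda_1\le\lambda_2\le\cdots$, $\lambda_j\to\infty$ (repeated according to multiplicity) and orthonormal basis $\{e_j\}_{j\ge1}$ of $H$ with $\mathcal Be_j=\lambda_je_j$. Let $P(s)=a_ms^m+\cdots+a_0$ be a real polynomial of degree $m\ge1$ with $a_m>0$. For $u=\sum_ju_je_j$, $u_j=\langle u,e_j\rangle_H$, set $P(\mathcal B)u=\sum_jP(\lambda_j)u_je_j$ on $\mathcal D(P(\mathcal B))=\{u\in H:\sum_j|P(\lambda_j)|^2|u_j|^2<\infty\}$ (graph norm), and $S_P(t)u=e^{-tP(\mathcal B)}u=\sum_je^{-tP(\lambda_j)}u_je_j$. Let $\mathcal M=\{u\in H:\|u\|_H=1\}$ and $\Pi_uv=v-\langle v,u\rangle_Hu$ for $u\in\mathcal M$, $v\in H$. The solution of $\partial_tu=-\Pi_uP(\mathcal B)u$ ($t>0$), $u(0)=u_0\in\mathcal M$, is the unique $\mathcal M$-valued solution in $C([0,\infty);H)\cap C((0,\infty);\mathcal D(P(\mathcal B)))\cap C^1((0,\infty);H)$, namely $u(t)=S_P(t)u_0/\|S_P(t)u_0\|_H$. For $\mu\in\mathbb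 R$, $\mathsf E_\mu$ is the orthogonal projection of $H$ onto $\ker(P(\mathcal B)-\mu I)$. For $v\in\mathcal M$, the active polynomial spectral set is $\Sigma_P(v)=\{P(\lambda_j):\langle v,e_j\rangle_H\ne0\}=\{\mu\in\sigma(P(\mathcal B)):\mathsf E_\mu v\ne0\}$. *)

theory Defs
  imports "HOL-Analysis.Analysis" "HOL-Computational_Algebra.Polynomial"
begin

section \<open>The real Hilbert space of square-integrable functions\<close>

definition sq_integrable :: "('a::euclidean_space \<Rightarrow> real) \<Rightarrow> bool" where
  "sq_integrable f \<longleftrightarrow>
     f \<in> borel_measurable lebesgue \<and> integrable lebesgue (\<lambda>x. (f x)\<^sup>2)"

lemma sq_integrable_0: "sq_integrable (\<lambda>x. 0)"
  by (simp add: sq_integrable_def)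

lemma sq_integrable_mult:
  assumes "sq_integrable f" "sq_integrable g"
  shows "integrable lebesgue (\<lambda>x. f x * g x)"
proof (rule Bochner_Integration.integrable_bound)
  show "integrable lebesgue (\<lambda>x. (f x)\<^sup>2 + (g x)\<^sup>2)"
    using assms by (auto simp: sq_integrable_def)
  show "(\<lambda>x. f x * g x) \<in> borel_measurable lebesgue"
    using assms by (auto simp: sq_integrable_def)
  have "\<bar>f x * g x\<bar> \<le> (f x)\<^sup>2 + (g x)\<^sup>2" for x
    using sum_squares_bound[of "\<bar>f x\<bar>" "\<bar>g x\<bar>"] zero_le_power2[of "f x"] zero_le_power2[of "g x"]
      mult_nonneg_nonneg[of "\<bar>f x\<bar>" "\<bar>g x\<bar>"]
    unfolding abs_mult power2_abs by linarith
  then show "AE x in lebesgue. norm (f x * g x) \<le> norm ((f x)\<^sup>2 + (g x)\<^sup>2)"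
    by (intro AE_I2) (simp del: real_norm_def add: real_norm_def)
qed

lemma sq_integrable_add:
  assumes "sq_integrable f" "sq_integrable g"
  shows "sq_integrable (\<lambda>x. f x + g x)"
proof -
  have "integrable lebesgue (\<lambda>x. (f x)\<^sup>2 + (g x)\<^sup>2 + 2 * (f x * g x))"
    using assms sq_integrable_mult[OF assms]
    by (intro Bochner_Integration.integrable_add integrable_mult_right)
      (auto simp: sq_integrable_def)
  moreover have "(\<lambda>x. (f x + g x)\<^sup>2) = (\<lambda>x. (f x)\<^sup>2 + (g x)\<^sup>2 + 2 * (f x * g x))"
    by (auto simp: power2_sum)
  ultimately show ?thesis
    using assms by (auto simp: sq_integrable_def)
qed

lemma sq_integrable_scale: "sq_integrable f \<Longrightarrow> sq_integrable (\<lambda>x. c * f x)"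
  by (auto simp: sq_integrable_def power_mult_distrib)

definition l2_rel :: "('a::euclidean_space \<Rightarrow> real) \<Rightarrow> ('a \<Rightarrow> real) \<Rightarrow> bool" where
  "l2_rel f g \<longleftrightarrow> sq_integrable f \<and> sq_integrable g \<and> (AE x in lebesgue. f x = g x)"

quotient_type (overloaded) 'a l2 = "'a::euclidean_space \<Rightarrow> real" / partial: l2_rel
proof (rule part_equivpI)
  show "\<exists>f::'a \<Rightarrow> real. l2_rel f f"
    using sq_integrable_0 by (auto simp: l2_rel_def)
  show "symp (l2_rel :: ('a \<Rightarrow> real) \<Rightarrow> _)"
    by (auto simp: symp_def l2_rel_def elim: eventually_mono)
  show "transp (l2_rel :: ('a \<Rightarrow> real) \<Rightarrow> _)"
    unfolding transp_def l2_rel_def by (auto elim: eventually_elim2)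
qed

instantiation l2 :: (euclidean_space) real_inner
begin

lift_definition zero_l2 :: "'a l2" is "\<lambda>x. 0"
  by (simp add: l2_rel_def sq_integrable_0)

lift_definition plus_l2 :: "'a l2 \<Rightarrow> 'a l2 \<Rightarrow> 'a l2" is "\<lambda>f g x. f x + g x"
  unfolding l2_rel_def by (auto intro: sq_integrable_add elim: eventually_elim2)

lift_definition scaleR_l2 :: "real \<Rightarrow> 'a l2 \<Rightarrow> 'a l2" is "\<lambda>c f x. c * f x"
  unfolding l2_rel_def by (auto intro: sq_integrable_scale elim: eventually_mono)

definition uminus_l2 :: "'a l2 \<Rightarrow> 'a l2" where "uminus_l2 f = (-1) *\<^sub>R f"

definition minus_l2 :: "'a l2 \<Rightarrow> 'a l2 \<Rightarrow> 'a l2" where "minus_l2 f g = f + - g"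

lift_definition inner_l2 :: "'a l2 \<Rightarrow> 'a l2 \<Rightarrow> real" is
  "\<lambda>f g. integral\<^sup>L lebesgue (\<lambda>x. f x * g x)"
proof -
  fix f f' g g' :: "'a \<Rightarrow> real"
  assume *: "l2_rel f f'" "l2_rel g g'"
  then show "integral\<^sup>L lebesgue (\<lambda>x. f x * g x) = integral\<^sup>L lebesgue (\<lambda>x. f' x * g' x)"
  proof (intro Bochner_Integration.integral_cong_AE)
    show "AE x in lebesgue. f x * g x = f' x * g' x"
      using * unfolding l2_rel_def by (auto elim: eventually_elim2)
  qed (auto simp: l2_rel_def sq_integrable_def)
qed

definition norm_l2 :: "'a l2 \<Rightarrow> real" where "norm_l2 f = sqrt (f \<bullet> f)"

definition sgn_l2 :: "'a l2 \<Rightarrow> 'a l2" where "sgn_l2 f = inverse (norm f) *\<^sub>R f"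

definition dist_l2 :: "'a l2 \<Rightarrow> 'a l2 \<Rightarrow> real" where "dist_l2 f g = norm (f - g)"

definition uniformity_l2 :: "('a l2 \<times> 'a l2) filter" where
  "uniformity_l2 = (INF e\<in>{0 <..}. principal {(x, y). dist x y < e})"

definition open_l2 :: "'a l2 set \<Rightarrow> bool" where
  "open_l2 U \<longleftrightarrow> (\<forall>x\<in>U. eventually (\<lambda>(x', y). x' = x \<longrightarrow> y \<in> U) uniformity)"

instance
proof
  fix f g h :: "'a l2" and a b r :: real
  show "f + g + h = f + (g + h)"
    by transfer (auto simp: l2_rel_def algebra_simps intro!: sq_integrable_add)
  show "f + g = g + f"
    by transfer (auto simp: l2_rel_def algebra_simps intro!: sq_integrable_add)
  show "0 + f = f"
    by transfer (auto simp: l2_rel_def)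
  show "- f + f = 0"
    unfolding uminus_l2_def
    by transfer (auto simp: l2_rel_def sq_integrable_0)
  show "f - g = f + - g"
    by (simp add: minus_l2_def)
  show "a *\<^sub>R (f + g) = a *\<^sub>R f + a *\<^sub>R g"
    by transfer (auto simp: l2_rel_def algebra_simps intro!: sq_integrable_add sq_integrable_scale)
  show "(a + b) *\<^sub>R f = a *\<^sub>R f + b *\<^sub>R f"
    by transfer (auto simp: l2_rel_def algebra_simps intro!: sq_integrable_add sq_integrable_scale)
  show "a *\<^sub>R b *\<^sub>R f = (a * b) *\<^sub>R f"
    by transfer (auto simp: l2_rel_def algebra_simps intro!: sq_integrable_scale)
  show "1 *\<^sub>R f = f"
    by transfer (auto simp: l2_rel_def)
  show "sgn f = inverse (norm f) *\<^sub>R f"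
    by (rule sgn_l2_def)
  show "dist f g = norm (f - g)"
    by (rule dist_l2_def)
  show "f \<bullet> g = g \<bullet> f"
    by transfer (simp add: mult.commute)
  show "(f + g) \<bullet> h = f \<bullet> h + g \<bullet> h"
    by transfer (simp add: l2_rel_def sq_integrable_mult distrib_right)
  show "(r *\<^sub>R f) \<bullet> g = r * (f \<bullet> g)"
    by transfer (simp add: mult.assoc)
  show "0 \<le> f \<bullet> f"
    by transfer (simp add: Bochner_Integration.integral_nonneg)
  show "f \<bullet> f = 0 \<longleftrightarrow> f = 0"
  proof transfer
    fix f :: "'a \<Rightarrow> real"
    assume "l2_rel f f"
    then have f: "sq_integrable f" by (simp add: l2_rel_def)
    then have "integral\<^sup>L lebesgue (\<lambda>x. f x * f x) = 0 \<longleftrightarrow> (AE x in lebesgue. f x * f x = 0)"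
      by (intro integral_nonneg_eq_0_iff_AE sq_integrable_mult) auto
    then show "integral\<^sup>L lebesgue (\<lambda>x. f x * f x) = 0 \<longleftrightarrow> l2_rel f (\<lambda>x. 0)"
      using f by (simp add: l2_rel_def sq_integrable_0)
  qed
  show "norm f = sqrt (f \<bullet> f)"
    by (rule norm_l2_def)
qed (simp_all add: uniformity_l2_def open_l2_def)

end


text \<open>
  The space \<open>L\<^sup>2(\<Omega>)\<close>, realised by extension by zero: the classes in \<open>L\<^sup>2\<close> of the whole space
  that vanish almost everywhere outside \<open>\<Omega>\<close>. Inner product and norm are those of \<^typ>\<open>'a l2\<close>.
\<close>

definition L2_on :: "'a::euclidean_space set \<Rightarrow> 'a l2 set" where
  "L2_on \<Omega> = {f. AE x in lebesgue. x \<notin> \<Omega> \<longrightarrow> rep_l2 f x = 0}"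


section \<open>Smooth bounded domains\<close>

definition partial_deriv :: "'a::euclidean_space \<Rightarrow> ('a \<Rightarrow> real) \<Rightarrow> 'a \<Rightarrow> real" where
  "partial_deriv i f = (\<lambda>x. frechet_derivative f (at x) i)"

primrec C_k :: "nat \<Rightarrow> ('a::euclidean_space \<Rightarrow> real) \<Rightarrow> bool" where
  "C_k 0 f \<longleftrightarrow> continuous_on UNIV f"
| "C_k (Suc k) f \<longleftrightarrow> (\<forall>x. f differentiable (at x)) \<and> (\<forall>i\<in>Basis. C_k k (partial_deriv i f))"

definition smooth :: "('a::euclidean_space \<Rightarrow> real) \<Rightarrow> bool" where
  "smooth f \<longleftrightarrow> (\<forall>k. C_k k f)"

text \<open>
  Near each boundary point, in suitable Cartesian coordinates with last axis \<open>n\<close>, the set is the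
  part of a ball lying above the graph of a smooth function \<open>\<gamma>\<close> of the remaining coordinates;
  \<open>y - (y \<bullet> n) *\<^sub>R n\<close> is the component of \<open>y\<close> orthogonal to \<open>n\<close>.
\<close>

definition smooth_boundary :: "'a::euclidean_space set \<Rightarrow> bool" where
  "smooth_boundary \<Omega> \<longleftrightarrow>
     (\<forall>x\<in>frontier \<Omega>. \<exists>r>0. \<exists>n \<gamma>. norm n = 1 \<and> smooth \<gamma> \<and>
        \<Omega> \<inter> ball x r = {y \<in> ball x r. \<gamma> (y - (y \<bullet> n) *\<^sub>R n) < y \<bullet> n})"

definition smooth_bounded_domain :: "'a::euclidean_space set \<Rightarrow> bool" where
  "smooth_bounded_domain \<Omega> \<longleftrightarrow>
     \<Omega> \<noteq> {} \<and> open \<Omega> \<and> connected \<Omega> \<and> bounded \<Omega> \<and> smooth_boundary \<Omega>"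


section \<open>Sobolev spaces and the Dirichlet Laplacian\<close>

definition test_function :: "'a::euclidean_space set \<Rightarrow> ('a \<Rightarrow> real) \<Rightarrow> bool" where
  "test_function \<Omega> \<phi> \<longleftrightarrow>
     smooth \<phi> \<and> compact (closure {x. \<phi> x \<noteq> 0}) \<and> closure {x. \<phi> x \<noteq> 0} \<subseteq> \<Omega>"

definition has_weak_partial ::
  "'a::euclidean_space set \<Rightarrow> 'a \<Rightarrow> 'a l2 \<Rightarrow> 'a l2 \<Rightarrow> bool" where
  "has_weak_partial \<Omega> i f g \<longleftrightarrow>
     (\<forall>\<phi>. test_function \<Omega> \<phi> \<longrightarrow>
        (\<integral>x\<in>\<Omega>. rep_l2 f x * partial_deriv i \<phi> x \<partial>lebesgue) =
        - (\<integral>x\<in>\<Omega>. rep_l2 g x * \<phi> x \<partial>lebesgue))"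

definition weak_partial :: "'a::euclidean_space set \<Rightarrow> 'a \<Rightarrow> 'a l2 \<Rightarrow> 'a l2" where
  "weak_partial \<Omega> i f = (THE g. g \<in> L2_on \<Omega> \<and> has_weak_partial \<Omega> i f g)"

primrec sobolev :: "nat \<Rightarrow> 'a::euclidean_space set \<Rightarrow> 'a l2 set" where
  "sobolev 0 \<Omega> = L2_on \<Omega>"
| "sobolev (Suc k) \<Omega> =
     {f \<in> L2_on \<Omega>. \<forall>i\<in>Basis. \<exists>g\<in>sobolev k \<Omega>. has_weak_partial \<Omega> i f g}"

text \<open>The closure of the test functions in the norm of \<^term>\<open>sobolev 1 \<Omega>\<close>.\<close>

definition sobolev_1_0 :: "'a::euclidean_space set \<Rightarrow> 'a l2 set" where
  "sobolev_1_0 \<Omega> =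
     {f \<in> sobolev 1 \<Omega>. \<exists>\<phi>. (\<forall>n::nat. test_function \<Omega> (\<phi> n)) \<and>
        (\<lambda>n. abs_l2 (\<phi> n)) \<longlonglongrightarrow> f \<and>
        (\<forall>i\<in>Basis. (\<lambda>n. abs_l2 (partial_deriv i (\<phi> n))) \<longlonglongrightarrow> weak_partial \<Omega> i f)}"

definition dirichlet_dom :: "'a::euclidean_space set \<Rightarrow> 'a l2 set" where
  "dirichlet_dom \<Omega> = sobolev 2 \<Omega> \<inter> sobolev_1_0 \<Omega>"

definition dirichlet_op :: "'a::euclidean_space set \<Rightarrow> 'a l2 \<Rightarrow> 'a l2" where
  "dirichlet_op \<Omega> f = - (\<Sum>i\<in>Basis. weak_partial \<Omega> i (weak_partial \<Omega> i f))"

text \<open>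
  Eigenvalues and eigenvectors are indexed from \<open>0\<close>: \<open>lam j\<close> and \<open>e j\<close> stand for
  \<open>\<lambda>\<^sub>j\<^sub>+\<^sub>1\<close> and \<open>e\<^sub>j\<^sub>+\<^sub>1\<close>.
\<close>

definition dirichlet_eigenbasis ::
  "'a::euclidean_space set \<Rightarrow> (nat \<Rightarrow> real) \<Rightarrow> (nat \<Rightarrow> 'a l2) \<Rightarrow> bool" where
  "dirichlet_eigenbasis \<Omega> lam e \<longleftrightarrow>
     (\<forall>j. e j \<in> dirichlet_dom \<Omega> \<and> dirichlet_op \<Omega> (e j) = lam j *\<^sub>R e j) \<and>
     (\<forall>i j. e i \<bullet> e j = (if i = j then 1 else 0)) \<and>
     closure (span (range e)) = L2_on \<Omega> \<and>
     0 < lam 0 \<and> mono lam \<and> filterlim lam at_top sequentially"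


section \<open>Functions of the Dirichlet Laplacian\<close>

definition poly_dom ::
  "'a::euclidean_space set \<Rightarrow> real poly \<Rightarrow> (nat \<Rightarrow> real) \<Rightarrow> (nat \<Rightarrow> 'a l2) \<Rightarrow> 'a l2 set" where
  "poly_dom \<Omega> P lam e =
     {u \<in> L2_on \<Omega>. summable (\<lambda>j. \<bar>poly P (lam j)\<bar>\<^sup>2 * \<bar>u \<bullet> e j\<bar>\<^sup>2)}"

definition poly_op ::
  "real poly \<Rightarrow> (nat \<Rightarrow> real) \<Rightarrow> (nat \<Rightarrow> 'a::euclidean_space l2) \<Rightarrow> 'a l2 \<Rightarrow> 'a l2" where
  "poly_op P lam e u = (\<Sum>j. (poly P (lam j) * (u \<bullet> e j)) *\<^sub>R e j)"

definition semigroup_op ::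
  "real poly \<Rightarrow> (nat \<Rightarrow> real) \<Rightarrow> (nat \<Rightarrow> 'a::euclidean_space l2) \<Rightarrow> real \<Rightarrow> 'a l2 \<Rightarrow> 'a l2" where
  "semigroup_op P lam e t u = (\<Sum>j. (exp (- t * poly P (lam j)) * (u \<bullet> e j)) *\<^sub>R e j)"

definition graph_norm ::
  "real poly \<Rightarrow> (nat \<Rightarrow> real) \<Rightarrow> (nat \<Rightarrow> 'a::euclidean_space l2) \<Rightarrow> 'a l2 \<Rightarrow> real" where
  "graph_norm P lam e u = sqrt ((norm u)\<^sup>2 + (norm (poly_op P lam e u))\<^sup>2)"

text \<open>The real spectrum of an operator \<open>A\<close> with domain \<open>D\<close> in the space \<open>H\<close>: the complement of the
  set of \<open>\<mu>\<close> for which \<open>A - \<mu> I\<close> maps \<open>D\<close> bijectively onto \<open>H\<close> with bounded inverse.\<close>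

definition spectrum ::
  "'b::real_normed_vector set \<Rightarrow> 'b set \<Rightarrow> ('b \<Rightarrow> 'b) \<Rightarrow> real set" where
  "spectrum H D A =
     {\<mu>. \<not> (bij_betw (\<lambda>u. A u - \<mu> *\<^sub>R u) D H \<and>
            (\<exists>C. \<forall>u\<in>D. norm u \<le> C * norm (A u - \<mu> *\<^sub>R u)))}"

abbreviation poly_spectrum ::
  "'a::euclidean_space set \<Rightarrow> real poly \<Rightarrow> (nat \<Rightarrow> real) \<Rightarrow> (nat \<Rightarrow> 'a l2) \<Rightarrow> real set" where
  "poly_spectrum \<Omega> P lam e \<equiv> spectrum (L2_on \<Omega>) (poly_dom \<Omega> P lam e) (poly_op P lam e)"

definition orth_proj :: "'b::real_inner set \<Rightarrow> 'b \<Rightarrow> 'b" where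
  "orth_proj K v = (THE w. w \<in> K \<and> (\<forall>z\<in>K. (v - w) \<bullet> z = 0))"

definition eigenproj ::
  "'a::euclidean_space set \<Rightarrow> real poly \<Rightarrow> (nat \<Rightarrow> real) \<Rightarrow> (nat \<Rightarrow> 'a l2) \<Rightarrow>
   real \<Rightarrow> 'a l2 \<Rightarrow> 'a l2" where
  "eigenproj \<Omega> P lam e \<mu> =
     orth_proj {u \<in> poly_dom \<Omega> P lam e. poly_op P lam e u - \<mu> *\<^sub>R u = 0}"

definition active_spectrum ::
  "real poly \<Rightarrow> (nat \<Rightarrow> real) \<Rightarrow> (nat \<Rightarrow> 'a::euclidean_space l2) \<Rightarrow> 'a l2 \<Rightarrow> real set" where
  "active_spectrum P lam e v = {poly P (lam j) | j. v \<bullet> e j \<noteq> 0}"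


section \<open>The projected flow on the unit sphere\<close>

definition unit_sphere :: "'a::euclidean_space set \<Rightarrow> 'a l2 set" where
  "unit_sphere \<Omega> = {u \<in> L2_on \<Omega>. norm u = 1}"

definition tangent_proj :: "'b::real_inner \<Rightarrow> 'b \<Rightarrow> 'b" where
  "tangent_proj u v = v - (v \<bullet> u) *\<^sub>R u"

text \<open>
  Only the values of \<open>u\<close> on \<open>[0,\<infinity>)\<close> matter. The four regularity requirements are membership of the
  sphere, \<open>C([0,\<infinity>);H)\<close>, \<open>C((0,\<infinity>);D(P(B)))\<close> for the graph norm, and \<open>C\<^sup>1((0,\<infinity>);H)\<close>.
\<close>

definition flow_solution ::
  "'a::euclidean_space set \<Rightarrow> real poly \<Rightarrow> (nat \<Rightarrow> real) \<Rightarrow> (nat \<Rightarrow> 'a l2) \<Rightarrow>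
   'a l2 \<Rightarrow> (real \<Rightarrow> 'a l2) \<Rightarrow> bool" where
  "flow_solution \<Omega> P lam e u0 u \<longleftrightarrow>
     (\<forall>t\<ge>0. u t \<in> unit_sphere \<Omega>) \<and>
     continuous_on {0..} u \<and>
     (\<forall>t>0. u t \<in> poly_dom \<Omega> P lam e \<and>
            ((\<lambda>s. graph_norm P lam e (u s - u t)) \<longlongrightarrow> 0) (at t)) \<and>
     (\<exists>u'. continuous_on {0<..} u' \<and>
           (\<forall>t>0. (u has_vector_derivative u' t) (at t) \<and>
                  u' t = - tangent_proj (u t) (poly_op P lam e (u t)))) \<and>
     u 0 = u0"

end

theory Submission
  imports Defs
begin

text \<open>
  Write \<open>p\<^sub>j = P(\<lambda>\<^sub>j)\<close> and \<open>w\<^sub>j(t) = \<langle>u(t), e\<^sub>j\<rangle>\<close>. Testing the equation against \<open>e\<^sub>j\<close> gives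
  \<open>w\<^sub>j' = (a - p\<^sub>j) w\<^sub>j\<close> for \<open>t > 0\<close>, where the scalar \<open>a(t) = \<langle>P(B)u(t), u(t)\<rangle>\<close> is the same for all \<open>j\<close>.
  Hence all the products \<open>exp(p\<^sub>j t) w\<^sub>j(t)\<close> satisfy one and the same scalar equation \<open>z' = a z\<close>,
  and between two positive times they are all multiplied by one common positive factor.

  The delicate point is \<open>t = 0\<close>: the function \<open>a\<close> may be unbounded near \<open>0\<close>, and its integrability there is not
  known in advance, so one cannot simply solve the scalar equation from the initial time. Instead one starts at \<open>t > 0\<close> and goes
  back to \<open>s \<rightarrow> 0\<close>. By continuity of \<open>u\<close> at \<open>0\<close> the common factor has a limit \<open>L\<close>, with
  \<open>\<langle>u\<^sub>0, e\<^sub>j\<rangle> = L exp(p\<^sub>j t) w\<^sub>j(t)\<close> for all \<open>j\<close>, and \<open>L \<noteq> 0\<close> because \<open>u\<^sub>0\<close> has a nonzero coefficient. This is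
  \<open>normalized_flow_coefficients\<close>. It says that \<open>S\<^sub>P(t)u\<^sub>0 = L u(t)\<close>; since \<open>u(t)\<close> is a unit vector,
  \<open>L\<close> is the norm of \<open>S\<^sub>P(t)u\<^sub>0\<close>, which Parseval turns into the series of the first formula.
  As \<open>L\<close> and the exponentials are positive, no coefficient appears or disappears.

  The projection onto \<open>ker(P(B) - \<mu>)\<close> keeps the coefficients with \<open>p\<^sub>j = \<mu>\<close> and deletes the others
  (\<open>eigenproj_sums\<close>), and the flow multiplies all those which remain by the same number
  \<open>exp(-\<mu>t) / L\<close>.

  The operators \<open>P(B)\<close> and \<open>S\<^sub>P(t)\<close> are sums of series in \<open>L\<^sup>2\<close>, so the argument rests on the completeness
  of that space (the Riesz-Fischer theorem), which is proved first.
\<close>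

section \<open>Completeness of the space of square-integrable functions\<close>

lemma sq_integrable_rep: "sq_integrable (rep_l2 f)"
  using Quotient_rep_reflp[OF Quotient_l2, of f] by (simp add: l2_rel_def)

lemma abs_rep_l2: "abs_l2 (rep_l2 f) = f"
  by (rule Quotient_abs_rep[OF Quotient_l2])

lemma abs_l2_diff:
  assumes "sq_integrable f" "sq_integrable g"
  shows "abs_l2 f - abs_l2 g = abs_l2 (\<lambda>x. f x - g x)"
proof -
  have "l2_rel f f" "l2_rel g g" "l2_rel (\<lambda>x. - 1 * g x) (\<lambda>x. - 1 * g x)"
    using assms sq_integrable_scale[of g "- 1"] by (auto simp: l2_rel_def)
  then show ?thesis
    unfolding minus_l2_def uminus_l2_def scaleR_l2.abs_eq[OF \<open>l2_rel g g\<close>]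
    by (subst plus_l2.abs_eq) auto
qed

lemma norm_abs_l2:
  assumes "sq_integrable f"
  shows "ennreal ((norm (abs_l2 f))\<^sup>2) = (\<integral>\<^sup>+x. ennreal ((f x)\<^sup>2) \<partial>lebesgue)"
proof -
  have "(norm (abs_l2 f))\<^sup>2 = integral\<^sup>L lebesgue (\<lambda>x. (f x)\<^sup>2)"
    using assms by (simp add: power2_norm_eq_inner inner_l2.abs_eq l2_rel_def flip: power2_eq_square)
  then show ?thesis
    using assms by (simp add: sq_integrable_def nn_integral_eq_integral)
qed

lemma norm_diff_l2:
  "ennreal ((norm (f - g))\<^sup>2) = (\<integral>\<^sup>+x. ennreal ((rep_l2 f x - rep_l2 g x)\<^sup>2) \<partial>lebesgue)"
proof -
  have "sq_integrable (\<lambda>x. rep_l2 f x - rep_l2 g x)"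
    using sq_integrable_add[OF sq_integrable_rep[of f] sq_integrable_scale[OF sq_integrable_rep[of g], of "-1"]]
    by simp
  then show ?thesis
    using abs_l2_diff[OF sq_integrable_rep sq_integrable_rep, of f g] norm_abs_l2
    by (simp add: abs_rep_l2)
qed

lemma Cauchy_fast_subseq:
  fixes X :: "nat \<Rightarrow> 'a::metric_space"
  assumes "Cauchy X"
  obtains r where "strict_mono r" "\<And>k m. k \<le> m \<Longrightarrow> dist (X (r m)) (X (r k)) \<le> (1/2) ^ k"
proof -
  have "\<forall>k. \<exists>N. \<forall>m\<ge>N. \<forall>n\<ge>N. dist (X m) (X n) < (1/2) ^ k"
    using assms unfolding Cauchy_def by simp
  then obtain N where N: "\<And>k m n. m \<ge> N k \<Longrightarrow> n \<ge> N k \<Longrightarrow> dist (X m) (X n) < (1/2) ^ k"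
    by metis
  define r where "r k = (\<Sum>i\<le>k. Suc (N i))" for k
  have "strict_mono r"
    unfolding strict_mono_Suc_iff r_def by simp
  moreover have "N k \<le> r k" for k
    unfolding r_def using member_le_sum[of k "{..k}" "\<lambda>i. Suc (N i)"] by simp
  moreover have "r k \<le> r m" if "k \<le> m" for k m
    using that \<open>strict_mono r\<close> by (simp add: strict_mono_less_eq)
  ultimately show ?thesis
    using that N by (meson less_imp_le order_trans)
qed

text \<open>
  Riesz-Fischer. Along a subsequence whose increments have norm at most \<open>2\<^sup>-\<^sup>k\<close> the representatives
  converge almost everywhere, and Fatou's lemma shows that the pointwise limit is also the limit in norm.
\<close>

instance l2 :: (euclidean_space) banach
proof
  fix X :: "nat \<Rightarrow> 'a l2"
  assume "Cauchy X"
  then obtain r where r: "strict_mono r"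
    and fast: "\<And>k m. k \<le> m \<Longrightarrow> dist (X (r m)) (X (r k)) \<le> (1/2) ^ k"
    using Cauchy_fast_subseq by blast
  define f where "f k = rep_l2 (X (r k))" for k
  have meas [measurable]: "f k \<in> borel_measurable lebesgue" for k
    using sq_integrable_rep by (auto simp: f_def sq_integrable_def)
  have int: "(\<integral>\<^sup>+x. ennreal ((f m x - f k x)\<^sup>2) \<partial>lebesgue) \<le> ennreal ((1/4) ^ k)" if "k \<le> m" for k m
  proof -
    have "(norm (X (r m) - X (r k)))\<^sup>2 \<le> ((1/2) ^ k)\<^sup>2"
      using fast[OF that] by (intro power_mono) (auto simp: dist_norm)
    also have "((1/2::real) ^ k)\<^sup>2 = (1/4) ^ k"
      by (simp add: power2_eq_square flip: power_mult_distrib)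
    finally show ?thesis
      by (simp add: f_def norm_diff_l2[symmetric] ennreal_leI)
  qed
  \<comment> \<open>The squared increments are so small in mean that the weights \<open>2 ^ k\<close> leave a finite integral;
    these weights make the increments themselves summable, since \<open>d \<le> 2\<^sup>-\<^sup>k + 2\<^sup>k d\<^sup>2\<close>.\<close>
  have "AE x in lebesgue. summable (\<lambda>k. f (Suc k) x - f k x)"
  proof -
    have "(\<integral>\<^sup>+x. (\<Sum>k. ennreal (2 ^ k * (f (Suc k) x - f k x)\<^sup>2)) \<partial>lebesgue)
        = (\<Sum>k. \<integral>\<^sup>+x. ennreal (2 ^ k * (f (Suc k) x - f k x)\<^sup>2) \<partial>lebesgue)"
      by (rule nn_integral_suminf) measurable
    also have "\<dots> \<le> (\<Sum>k. ennreal ((1/2) ^ k))"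
    proof (rule suminf_le)
      fix k
      have "(\<integral>\<^sup>+x. ennreal (2 ^ k * (f (Suc k) x - f k x)\<^sup>2) \<partial>lebesgue)
          = ennreal (2 ^ k) * (\<integral>\<^sup>+x. ennreal ((f (Suc k) x - f k x)\<^sup>2) \<partial>lebesgue)"
        by (subst nn_integral_cmult[symmetric]) (auto simp: ennreal_mult)
      also have "\<dots> \<le> ennreal (2 ^ k) * ennreal ((1/4) ^ k)"
        by (intro mult_left_mono int) auto
      also have "\<dots> = ennreal ((1/2) ^ k)"
        by (simp add: ennreal_mult[symmetric] flip: power_mult_distrib)
      finally show "(\<integral>\<^sup>+x. ennreal (2 ^ k * (f (Suc k) x - f k x)\<^sup>2) \<partial>lebesgue) \<le> ennreal ((1/2) ^ k)" .
    qed auto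
    also have "\<dots> < \<infinity>"
      unfolding infinity_ennreal_def less_top[symmetric]
      by (intro ennreal_suminf_neq_top summable_geometric) auto
    finally have "AE x in lebesgue. (\<Sum>k. ennreal (2 ^ k * (f (Suc k) x - f k x)\<^sup>2)) \<noteq> \<infinity>"
      by (intro nn_integral_PInf_AE) auto
    then show ?thesis
    proof eventually_elim
      case (elim x)
      then have "summable (\<lambda>k. 2 ^ k * (f (Suc k) x - f k x)\<^sup>2)"
        by (intro summable_suminf_not_top) auto
      then have "summable (\<lambda>k. (1/2) ^ k + 2 ^ k * (f (Suc k) x - f k x)\<^sup>2)"
        by (intro summable_add summable_geometric) auto
      then show ?case
      proof (rule summable_comparison_test')
        fix k
        let ?d = "\<bar>f (Suc k) x - f k x\<bar>" and ?s = "(2::real) ^ k"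
        have "0 \<le> (?s * ?d - 1)\<^sup>2"
          by simp
        also have "\<dots> = ?s * (?s * ?d\<^sup>2 + 1 / ?s - 2 * ?d)"
          by (simp add: power2_eq_square algebra_simps)
        finally have "2 * ?d \<le> ?s * ?d\<^sup>2 + 1 / ?s"
          by (auto simp: zero_le_mult_iff power_le_zero_eq)
        then have "?d \<le> ?s * ?d\<^sup>2 + 1 / ?s"
          by (rule order_trans[rotated]) simp
        then show "norm (f (Suc k) x - f k x) \<le> (1/2) ^ k + 2 ^ k * (f (Suc k) x - f k x)\<^sup>2"
          by (simp add: power_one_over add.commute)
      qed
    qed
  qed
  then have conv: "AE x in lebesgue. (\<lambda>k. f k x) \<longlonglongrightarrow> lim (\<lambda>k. f k x)"
  proof eventually_elim
    case (elim x)
    then have "convergent (\<lambda>n. \<Sum>k<n. f (Suc k) x - f k x)"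
      by (simp add: summable_iff_convergent)
    then have "convergent (\<lambda>n. f n x - f 0 x)"
      unfolding sum_lessThan_telescope[of "\<lambda>k. f k x"] .
    then have "convergent (\<lambda>n. f n x)"
      by (simp add: convergent_diff_const_right_iff)
    then show ?case
      by (simp add: convergent_LIMSEQ_iff)
  qed
  define F where "F x = lim (\<lambda>k. f k x)" for x
  have F [measurable]: "F \<in> borel_measurable lebesgue"
    unfolding F_def by measurable
  \<comment> \<open>Fatou's lemma, with \<open>m \<rightarrow> \<infinity>\<close> in the estimate \<open>int\<close>.\<close>
  have Fint: "(\<integral>\<^sup>+x. ennreal ((F x - f k x)\<^sup>2) \<partial>lebesgue) \<le> ennreal ((1/4) ^ k)" for k
  proof -
    have "(\<integral>\<^sup>+x. ennreal ((F x - f k x)\<^sup>2) \<partial>lebesgue)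
        = (\<integral>\<^sup>+x. liminf (\<lambda>m. ennreal ((f m x - f k x)\<^sup>2)) \<partial>lebesgue)"
    proof (rule nn_integral_cong_AE, use conv in eventually_elim)
      case (elim x)
      then have "(\<lambda>m. ennreal ((f m x - f k x)\<^sup>2)) \<longlonglongrightarrow> ennreal ((F x - f k x)\<^sup>2)"
        unfolding F_def by (intro tendsto_ennrealI tendsto_intros)
      then show ?case
        by (rule lim_imp_Liminf[OF sequentially_bot, symmetric])
    qed
    also have "\<dots> \<le> liminf (\<lambda>m. \<integral>\<^sup>+x. ennreal ((f m x - f k x)\<^sup>2) \<partial>lebesgue)"
      by (rule nn_integral_liminf) measurable
    also have "\<dots> \<le> ennreal ((1/4) ^ k)"
      by (intro Liminf_le) (auto intro!: eventually_sequentiallyI[of k] int)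
    finally show ?thesis .
  qed
  have sqd: "sq_integrable (\<lambda>x. F x - f k x)" for k
    unfolding sq_integrable_def
  proof
    show "integrable lebesgue (\<lambda>x. (F x - f k x)\<^sup>2)"
      using Fint[of k] by (intro integrableI_nonneg) (auto intro: le_less_trans)
  qed measurable
  have "sq_integrable (\<lambda>x. (F x - f 0 x) + f 0 x)"
    by (intro sq_integrable_add sqd) (simp add: f_def sq_integrable_rep)
  then have sqF: "sq_integrable F"
    by simp
  have "dist (X (r k)) (abs_l2 F) \<le> (1/2) ^ k" for k
  proof -
    have "abs_l2 F - X (r k) = abs_l2 (\<lambda>x. F x - f k x)"
      using abs_l2_diff[OF sqF sq_integrable_rep, of "X (r k)"] by (simp add: abs_rep_l2 f_def)
    then have "ennreal ((norm (abs_l2 F - X (r k)))\<^sup>2) \<le> ennreal ((1/4) ^ k)"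
      using Fint[of k] by (simp add: norm_abs_l2[OF sqd])
    then have "(norm (abs_l2 F - X (r k)))\<^sup>2 \<le> (1/4) ^ k"
      by simp
    also have "\<dots> = ((1/2) ^ k)\<^sup>2"
      by (simp add: power2_eq_square flip: power_mult_distrib)
    finally have "norm (abs_l2 F - X (r k)) \<le> (1/2) ^ k"
      by (rule power2_le_imp_le) simp
    then show ?thesis
      by (simp add: dist_norm norm_minus_commute)
  qed
  then have "(X \<circ> r) \<longlonglongrightarrow> abs_l2 F"
    by (intro metric_tendsto_imp_tendsto[OF LIMSEQ_power_zero[of "1/2::real"]])
      (auto intro!: always_eventually)
  then show "convergent X"
    using Cauchy_converges_subseq[OF \<open>Cauchy X\<close> r] by (auto simp: convergent_def)
qed


section \<open>Orthonormal expansions\<close>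

text \<open>
  The orthonormal sequence is a basis of the closure \<open>H\<close> of its span only; for the Dirichlet
  eigenfunctions \<open>H\<close> is \<open>L\<^sup>2(\<Omega>)\<close>, a proper subspace of the ambient \<open>L\<^sup>2\<close> space.
\<close>

locale hilbert_basis =
  fixes e :: "nat \<Rightarrow> 'b::{real_inner, banach}"
  assumes orthonormal: "e i \<bullet> e j = (if i = j then 1 else 0)"
begin

abbreviation H :: "'b set" where "H \<equiv> closure (span (range e))"

lemma norm_sum_sq:
  assumes "finite A"
  shows "(norm (\<Sum>j\<in>A. a j *\<^sub>R e j))\<^sup>2 = (\<Sum>j\<in>A. (a j)\<^sup>2)"
proof -
  have "(norm (\<Sum>j\<in>A. a j *\<^sub>R e j))\<^sup>2 = (\<Sum>j\<in>A. (norm (a j *\<^sub>R e j))\<^sup>2)"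
    using assms by (intro norm_sum_Pythagorean) (auto simp: pairwise_def orthogonal_def orthonormal)
  also have "\<dots> = (\<Sum>j\<in>A. (a j)\<^sup>2)"
    by (simp add: power_mult_distrib norm_eq_sqrt_inner orthonormal)
  finally show ?thesis .
qed

text \<open>By Pythagoras the tails of the series are controlled by the tails of \<open>\<Sum>a\<^sub>j\<^sup>2\<close>; completeness does the rest.\<close>

lemma summable_series:
  assumes "summable (\<lambda>j. (a j)\<^sup>2)"
  shows "summable (\<lambda>j. a j *\<^sub>R e j)"
  unfolding summable_Cauchy
proof (intro allI impI)
  fix \<epsilon> :: real
  assume "\<epsilon> > 0"
  then obtain N where N: "\<And>m n. m \<ge> N \<Longrightarrow> norm (\<Sum>j=m..<n. (a j)\<^sup>2) < \<epsilon>\<^sup>2"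
    using assms unfolding summable_Cauchy by (meson zero_less_power)
  have "norm (\<Sum>j=m..<n. a j *\<^sub>R e j) < \<epsilon>" if "m \<ge> N" for m n
    using N[OF that, of n] \<open>\<epsilon> > 0\<close> norm_sum_sq[of "{m..<n}" a]
    by (intro power2_less_imp_less[of _ \<epsilon>]) auto
  then show "\<exists>N. \<forall>m\<ge>N. \<forall>n. norm (\<Sum>j=m..<n. a j *\<^sub>R e j) < \<epsilon>"
    by blast
qed

lemma inner_suminf:
  assumes "summable (\<lambda>j. a j *\<^sub>R e j)"
  shows "(\<Sum>j. a j *\<^sub>R e j) \<bullet> e i = a i"
proof -
  have "(\<lambda>j. (a j *\<^sub>R e j) \<bullet> e i) sums ((\<Sum>j. a j *\<^sub>R e j) \<bullet> e i)"
    by (intro bounded_linear.sums[OF bounded_linear_inner_left] summable_sums assms)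
  moreover have "(\<lambda>j. (a j *\<^sub>R e j) \<bullet> e i) sums a i"
    using sums_single[of i "\<lambda>j. a j"] by (simp add: orthonormal if_distrib cong: if_cong)
  ultimately show ?thesis
    by (rule sums_unique2)
qed

lemma suminf_in_H:
  assumes "summable (\<lambda>j. a j *\<^sub>R e j)"
  shows "(\<Sum>j. a j *\<^sub>R e j) \<in> H"
  unfolding closure_sequential
proof (intro exI conjI allI)
  show "(\<lambda>n. \<Sum>j<n. a j *\<^sub>R e j) \<longlonglongrightarrow> (\<Sum>j. a j *\<^sub>R e j)"
    using summable_sums[OF assms] by (simp add: sums_def)
qed (intro span_sum span_mul span_base rangeI)

lemma orthogonal_H:
  assumes "\<And>j. e j \<bullet> x = 0" "v \<in> H"
  shows "v \<bullet> x = 0"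
proof -
  have "span (range e) \<subseteq> {y. y \<bullet> x = 0}"
    using assms(1) by (intro span_minimal) (auto simp: subspace_def inner_add_left)
  moreover have "closed {y. y \<bullet> x = 0}"
    by (intro closed_Collect_eq continuous_intros)
  ultimately show ?thesis
    using assms(2) closure_minimal by blast
qed

lemma bessel: "summable (\<lambda>j. (v \<bullet> e j)\<^sup>2)"
proof (rule summableI_nonneg_bounded)
  fix n
  let ?s = "\<Sum>j<n. (v \<bullet> e j) *\<^sub>R e j"
  have "v \<bullet> ?s = (\<Sum>j<n. (v \<bullet> e j)\<^sup>2)"
    by (simp add: inner_sum_right power2_eq_square)
  moreover have "(norm (v - ?s))\<^sup>2 = (norm v)\<^sup>2 - 2 * (v \<bullet> ?s) + (norm ?s)\<^sup>2"
    by (simp add: power2_norm_eq_inner inner_diff_left inner_diff_right inner_commute)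
  ultimately show "(\<Sum>j<n. (v \<bullet> e j)\<^sup>2) \<le> (norm v)\<^sup>2"
    using norm_sum_sq[of "{..<n}" "\<lambda>j. v \<bullet> e j"] zero_le_power2[of "norm (v - ?s)"] by simp
qed simp

text \<open>
  The difference \<open>v - w\<close> between a vector and the sum of its Fourier series is orthogonal to every \<open>e\<^sub>j\<close>,
  hence to \<open>H\<close>, which contains both \<open>v\<close> and \<open>w\<close>; so it is orthogonal to itself.
\<close>

lemma expansion:
  assumes "v \<in> H"
  shows "(\<lambda>j. (v \<bullet> e j) *\<^sub>R e j) sums v"
proof -
  define w where "w = (\<Sum>j. (v \<bullet> e j) *\<^sub>R e j)"
  have sm: "summable (\<lambda>j. (v \<bullet> e j) *\<^sub>R e j)"
    by (rule summable_series[OF bessel])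
  have perp: "e j \<bullet> (v - w) = 0" for j
    using inner_suminf[OF sm, of j] by (simp add: w_def inner_diff_right inner_commute)
  have "v \<bullet> (v - w) = 0" "w \<bullet> (v - w) = 0"
    using orthogonal_H[OF perp] assms suminf_in_H[OF sm] by (simp_all add: w_def)
  then have "(v - w) \<bullet> (v - w) = 0"
    by (simp add: inner_diff_left)
  then have "v = w"
    by simp
  then show ?thesis
    using summable_sums[OF sm] by (simp add: w_def)
qed

lemma parseval:
  assumes "v \<in> H"
  shows "(\<lambda>j. (v \<bullet> e j) * (w \<bullet> e j)) sums (v \<bullet> w)"
  using bounded_linear.sums[OF bounded_linear_inner_left[of w] expansion[OF assms]]
  by (simp add: inner_commute)

end


section \<open>The flow in coordinates\<close>

text \<open>
  The factor \<open>g = exp (\<integral>\<^sub>s\<^sup>t a)\<close> does not depend on the solution. This uniformity is what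
  lets all coefficients of the flow be compared at once.
\<close>

lemma linear_ode_common_factor:
  fixes a :: "real \<Rightarrow> real"
  assumes "s \<le> t" "continuous_on {s..t} a"
  obtains g where "g > 0"
    "\<And>z. (\<And>x. x \<in> {s..t} \<Longrightarrow> (z has_real_derivative a x * z x) (at x)) \<Longrightarrow> z t = g * z s"
proof -
  obtain A where A: "\<And>x. x \<in> {s..t} \<Longrightarrow> (A has_vector_derivative a x) (at x within {s..t})"
    using antiderivative_continuous[OF assms(2)] by blast
  have "z t = exp (A t - A s) * z s"
    if z: "\<And>x. x \<in> {s..t} \<Longrightarrow> (z has_real_derivative a x * z x) (at x)" for z
  proof -
    have "((\<lambda>x. exp (- A x) * z x) has_real_derivative 0) (at x within {s..t})" if "x \<in> {s..t}" for x
    proof -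
      have [derivative_intros]: "(A has_real_derivative a x) (at x within {s..t})"
        using A[OF that] by (simp add: has_real_derivative_iff_has_vector_derivative)
      have [derivative_intros]: "(z has_real_derivative a x * z x) (at x within {s..t})"
        using z[OF that] by (rule has_field_derivative_at_within)
      show ?thesis
        by (auto intro!: derivative_eq_intros)
    qed
    then have "\<exists>c. \<forall>x\<in>{s..t}. exp (- A x) * z x = c"
      by (intro has_field_derivative_zero_constant convex_real_interval)
    then obtain c where "\<forall>x\<in>{s..t}. exp (- A x) * z x = c"
      by blast
    then have "exp (- A t) * z t = exp (- A s) * z s"
      using \<open>s \<le> t\<close> by auto
    then show ?thesis
      by (simp add: exp_diff exp_minus field_simps)
  qed
  then show ?thesis
    using that[of "exp (A t - A s)"] by simp
qed

context hilbert_basis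
begin

text \<open>
  Continuity of \<open>a\<close> is assumed for positive times only, and \<open>a\<close> may blow up at \<open>0\<close>. For such an \<open>a\<close> a solution of
  \<open>z' = a z\<close> need not be determined by \<open>z(0)\<close>: for \<open>a(t) = 1/t\<close> both \<open>0\<close> and \<open>t\<close> are solutions with
  initial value \<open>0\<close>. What excludes this is that all coefficients carry the same factor and that \<open>u(0)\<close> is not zero.
\<close>

lemma normalized_flow_coefficients:
  fixes u :: "real \<Rightarrow> 'b" and a :: "real \<Rightarrow> real" and p :: "nat \<Rightarrow> real"
  assumes H: "u 0 \<in> H" and unit: "norm (u 0) = 1"
    and cont: "continuous_on {0..} u" and a: "continuous_on {0<..} a"
    and deriv: "\<And>t j. t > 0 \<Longrightarrow>
      ((\<lambda>s. u s \<bullet> e j) has_real_derivative (a t - p j) * (u t \<bullet> e j)) (at t)"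
    and t: "t \<ge> 0"
  obtains L where "L > 0" "\<And>j. u t \<bullet> e j = exp (- p j * t) * (u 0 \<bullet> e j) / L"
proof (cases "t = 0")
  case True
  then show ?thesis
    using that[of 1] by simp
next
  case False
  with t have "t > 0"
    by simp
  define z where "z j s = exp (p j * s) * (u s \<bullet> e j)" for j s
  have dz: "(z j has_real_derivative a s * z j s) (at s)" if "s > 0" for j s
    unfolding z_def
    by (auto intro!: derivative_eq_intros deriv[OF that] simp: algebra_simps)
  have "\<exists>g>0. \<forall>j. z j s = g * z j t" if s: "0 < s" "s \<le> t" for s
  proof -
    have "continuous_on {s..t} a"
      using a s by (rule_tac continuous_on_subset) auto
    from linear_ode_common_factor[OF \<open>s \<le> t\<close> this] obtain h where
      h: "h > 0" "\<And>z. (\<And>x. x \<in> {s..t} \<Longrightarrow> (z has_real_derivative a x * z x) (at x)) \<Longrightarrow> z t = h * z s"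
      by blast
    have "z j t = h * z j s" for j
      using s by (intro h(2) dz) auto
    then show ?thesis
      using h(1) by (intro exI[of _ "1 / h"]) auto
  qed
  then have "\<forall>s. \<exists>g. 0 < s \<and> s \<le> t \<longrightarrow> g > 0 \<and> (\<forall>j. z j s = g * z j t)"
    by blast
  from choice[OF this] obtain g where g: "\<And>s. 0 < s \<Longrightarrow> s \<le> t \<Longrightarrow> g s > 0"
    "\<And>s j. 0 < s \<Longrightarrow> s \<le> t \<Longrightarrow> z j s = g s * z j t"
    by blast
  \<comment> \<open>All the limits below are for \<open>s\<close> decreasing to \<open>0\<close>, with \<open>t\<close> fixed.\<close>
  have near: "\<forall>\<^sub>F s in at_right 0. 0 < s \<and> s \<le> t"
    using \<open>t > 0\<close> by (auto simp: eventually_at_right intro!: exI[of _ t])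
  have "(u \<longlongrightarrow> u 0) (at_right 0)"
  proof -
    have "(u \<longlongrightarrow> u 0) (at 0 within {0..})"
      using cont by (simp add: continuous_on)
    then show ?thesis
      by (rule tendsto_within_subset) auto
  qed
  then have "(z j \<longlongrightarrow> exp (p j * 0) * (u 0 \<bullet> e j)) (at_right 0)" for j
    unfolding z_def by (intro tendsto_intros)
  then have zlim: "(z j \<longlongrightarrow> u 0 \<bullet> e j) (at_right 0)" for j
    by simp
  then have lim: "((\<lambda>s. g s * z j t) \<longlongrightarrow> u 0 \<bullet> e j) (at_right 0)" for j
  proof -
    have "\<forall>\<^sub>F s in at_right 0. z j s = g s * z j t"
      by (rule eventually_mono[OF near]) (blast intro: g(2))
    from tendsto_cong[OF this] zlim[of j] show ?thesis
      by simp
  qed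
  have "\<exists>k. u 0 \<bullet> e k \<noteq> 0"
  proof (rule ccontr)
    assume "\<not> ?thesis"
    then have "(\<lambda>j. 0) sums u 0"
      using expansion[OF H] by simp
    then show False
      using unit sums_unique2[OF sums_zero] by force
  qed
  \<comment> \<open>A single nonzero coefficient determines the limit of the common factor.\<close>
  then obtain k where k: "u 0 \<bullet> e k \<noteq> 0"
    by blast
  have zk: "z k t \<noteq> 0"
  proof
    assume "z k t = 0"
    then have "((\<lambda>s. 0) \<longlongrightarrow> u 0 \<bullet> e k) (at_right (0::real))"
      using lim[of k] by simp
    then show False
      using k by (simp add: tendsto_const_iff)
  qed
  define L where "L = (u 0 \<bullet> e k) / z k t"
  have gL: "(g \<longlongrightarrow> L) (at_right 0)"
    using tendsto_divide[OF lim[of k] tendsto_const, of "z k t"] zk by (simp add: L_def)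
  have eq: "u 0 \<bullet> e j = L * z j t" for j
    by (rule tendsto_unique[OF _ lim tendsto_mult[OF gL tendsto_const]]) simp
  have "L \<ge> 0"
    using gL g(1) by (intro tendsto_lowerbound[OF gL] eventually_mono[OF near]) (auto intro: less_imp_le)
  moreover have "L \<noteq> 0"
    using k zk by (simp add: L_def)
  ultimately have "L > 0"
    by simp
  moreover have "u t \<bullet> e j = exp (- p j * t) * (u 0 \<bullet> e j) / L" for j
    using \<open>L > 0\<close> by (simp add: eq z_def exp_minus field_simps)
  ultimately show ?thesis
    by (rule that)
qed

end

text \<open>
  Continuity of the Rayleigh quotient \<open>a(t) = \<langle>P(B)u(t), u(t)\<rangle>\<close> for \<open>t > 0\<close> comes from the
  continuity of \<open>u\<close> in the graph norm.
\<close>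

lemma flow_solution_coefficients:
  fixes e :: "nat \<Rightarrow> 'a::euclidean_space l2"
  assumes basis: "hilbert_basis e" and L2: "closure (span (range e)) = L2_on \<Omega>"
    and sol: "flow_solution \<Omega> P lam e u0 u" and t: "t \<ge> 0"
  obtains L where "L > 0" "\<And>j. u t \<bullet> e j = exp (- poly P (lam j) * t) * (u0 \<bullet> e j) / L"
proof -
  interpret hilbert_basis e
    by (rule basis)
  have dom: "u s \<in> poly_dom \<Omega> P lam e" if "s > 0" for s
    using sol that by (auto simp: flow_solution_def)
  have sm: "summable (\<lambda>j. (poly P (lam j) * (u s \<bullet> e j)) *\<^sub>R e j)" if "s > 0" for s
    using dom[OF that] by (intro summable_series) (simp add: poly_dom_def power_mult_distrib)
  define A where "A s = poly_op P lam e (u s)" for s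
  have coeff: "A s \<bullet> e j = poly P (lam j) * (u s \<bullet> e j)" if "s > 0" for s j
    unfolding A_def poly_op_def by (rule inner_suminf[OF sm[OF that]])
  have contA: "continuous_on {0<..} A"
  proof (intro continuous_at_imp_continuous_on ballI)
    fix s :: real
    assume "s \<in> {0<..}"
    then have s: "s > 0"
      by simp
    have "\<forall>\<^sub>F r in at s. r > 0"
      using s by (intro order_tendstoD(1)[OF tendsto_ident_at])
    then have "\<forall>\<^sub>F r in at s. norm (A r - A s) \<le> graph_norm P lam e (u r - u s)"
    proof eventually_elim
      case (elim r)
      have "A r - A s = poly_op P lam e (u r - u s)"
        unfolding A_def poly_op_def
        by (simp add: suminf_diff[OF sm[OF elim] sm[OF s]] inner_diff_left algebra_simps)
      then show ?case
        by (simp add: graph_norm_def real_le_rsqrt)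
    qed
    moreover have "((\<lambda>r. graph_norm P lam e (u r - u s)) \<longlongrightarrow> 0) (at s)"
      using sol s by (auto simp: flow_solution_def)
    ultimately have "((\<lambda>r. A r - A s) \<longlongrightarrow> 0) (at s)"
      by (rule Lim_null_comparison)
    then show "isCont A s"
      by (simp add: isCont_def LIM_zero_iff)
  qed
  define a where "a s = A s \<bullet> u s" for s
  have cont: "continuous_on {0..} u"
    using sol by (simp add: flow_solution_def)
  have conta: "continuous_on {0<..} a"
    unfolding a_def
    by (intro continuous_on_inner contA continuous_on_subset[OF cont]) auto
  have deriv: "((\<lambda>r. u r \<bullet> e j) has_real_derivative (a s - poly P (lam j)) * (u s \<bullet> e j)) (at s)"
    if s: "s > 0" for s j
  proof -
    have "(u has_vector_derivative - (A s - a s *\<^sub>R u s)) (at s)"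
      using sol s unfolding flow_solution_def tangent_proj_def A_def a_def by metis
    then have "((\<lambda>r. u r \<bullet> e j) has_vector_derivative (- (A s - a s *\<^sub>R u s)) \<bullet> e j) (at s)"
      by (rule bounded_linear.has_vector_derivative[OF bounded_linear_inner_left])
    then show ?thesis
      by (simp add: has_real_derivative_iff_has_vector_derivative inner_diff_left coeff[OF s]
          algebra_simps)
  qed
  have u0: "u 0 = u0" "u 0 \<in> H" "norm (u 0) = 1"
    using sol by (auto simp: flow_solution_def unit_sphere_def L2)
  show ?thesis
    using normalized_flow_coefficients[where p = "\<lambda>j. poly P (lam j)",
        OF u0(2,3) cont conta deriv t] that u0(1) by metis
qed


section \<open>Spectral projections\<close>

text \<open>
  Two candidates \<open>w\<close> and \<open>w'\<close> lie in \<open>K\<close> themselves, so \<open>(w' - w) \<bullet> (w' - w)\<close> expands into four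
  terms that vanish by orthogonality. Since \<open>orth_proj\<close> is a definite description, this uniqueness is
  needed to compute it.
\<close>

lemma orth_proj_eqI:
  assumes w: "w \<in> K" "\<And>z. z \<in> K \<Longrightarrow> (v - w) \<bullet> z = 0"
  shows "orth_proj K v = w"
  unfolding orth_proj_def
proof (rule the_equality)
  fix w'
  assume w': "w' \<in> K \<and> (\<forall>z\<in>K. (v - w') \<bullet> z = 0)"
  have "(w' - w) \<bullet> (w' - w) = (v - w) \<bullet> w' - (v - w) \<bullet> w - (v - w') \<bullet> w' + (v - w') \<bullet> w"
    by (simp add: inner_diff_left inner_diff_right)
  also have "\<dots> = 0"
    using w w' by simp
  finally show "w' = w"
    by simp
qed (use w in auto)

text \<open>
  A vector of \<open>ker(P(B) - \<mu>)\<close> has no coefficient at an index with \<open>P(\<lambda>\<^sub>j) \<noteq> \<mu>\<close>, and deleting these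
  coefficients from \<open>v\<close> produces a vector of this kernel. The result is stated as a series because in this
  form it is visibly linear in the coefficients of \<open>v\<close>.
\<close>

lemma eigenproj_sums:
  fixes e :: "nat \<Rightarrow> 'a::euclidean_space l2"
  assumes basis: "hilbert_basis e" and L2: "closure (span (range e)) = L2_on \<Omega>"
    and v: "v \<in> L2_on \<Omega>"
  shows "(\<lambda>j. (if poly P (lam j) = \<mu> then v \<bullet> e j else 0) *\<^sub>R e j) sums eigenproj \<Omega> P lam e \<mu> v"
proof -
  interpret hilbert_basis e
    by (rule basis)
  define c where "c j = (if poly P (lam j) = \<mu> then v \<bullet> e j else 0)" for j
  have c2: "summable (\<lambda>j. (c j)\<^sup>2)"
    by (rule summable_comparison_test'[OF bessel[of v], of 0]) (simp add: c_def)
  have sm: "summable (\<lambda>j. c j *\<^sub>R e j)"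
    by (rule summable_series[OF c2])
  define w where "w = (\<Sum>j. c j *\<^sub>R e j)"
  have we: "w \<bullet> e j = c j" for j
    unfolding w_def by (rule inner_suminf[OF sm])
  have pc: "poly P (lam j) * c j = \<mu> * c j" for j
    by (simp add: c_def)
  have "eigenproj \<Omega> P lam e \<mu> v = w"
    unfolding eigenproj_def
  proof (rule orth_proj_eqI)
    have "poly_op P lam e w = (\<Sum>j. \<mu> *\<^sub>R (c j *\<^sub>R e j))"
      by (simp add: poly_op_def we pc)
    also have "\<dots> = \<mu> *\<^sub>R w"
      unfolding w_def by (rule suminf_scaleR_right[OF sm, symmetric])
    finally have "poly_op P lam e w - \<mu> *\<^sub>R w = 0"
      by simp
    moreover have "\<bar>poly P (lam j)\<bar>\<^sup>2 * \<bar>w \<bullet> e j\<bar>\<^sup>2 = \<mu>\<^sup>2 * (c j)\<^sup>2" for j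
      by (simp add: we pc flip: power_mult_distrib)
    then have "w \<in> poly_dom \<Omega> P lam e"
      using suminf_in_H[OF sm] by (simp add: poly_dom_def L2 w_def[symmetric] c2)
    ultimately show "w \<in> {u \<in> poly_dom \<Omega> P lam e. poly_op P lam e u - \<mu> *\<^sub>R u = 0}"
      by simp
  next
    fix z
    assume "z \<in> {u \<in> poly_dom \<Omega> P lam e. poly_op P lam e u - \<mu> *\<^sub>R u = 0}"
    then have z: "z \<in> poly_dom \<Omega> P lam e" "poly_op P lam e z = \<mu> *\<^sub>R z"
      by simp_all
    have "summable (\<lambda>j. (poly P (lam j) * (z \<bullet> e j)) *\<^sub>R e j)"
      using z(1) by (intro summable_series) (simp add: poly_dom_def power_mult_distrib)
    then have "poly_op P lam e z \<bullet> e j = poly P (lam j) * (z \<bullet> e j)" for j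
      unfolding poly_op_def by (rule inner_suminf)
    then have off: "poly P (lam j) = \<mu> \<or> z \<bullet> e j = 0" for j
      using z(2) by (metis inner_scaleR_left mult_cancel_right)
    have "(\<lambda>j. (z \<bullet> e j) * ((v - w) \<bullet> e j)) = (\<lambda>j. 0)"
      using off by (fastforce simp: inner_diff_left we c_def)
    moreover have "(\<lambda>j. (z \<bullet> e j) * ((v - w) \<bullet> e j)) sums (z \<bullet> (v - w))"
      using z(1) by (intro parseval) (simp add: poly_dom_def L2)
    ultimately have "z \<bullet> (v - w) = 0"
      using sums_unique2[OF _ sums_zero] by metis
    then show "(v - w) \<bullet> z = 0"
      by (simp add: inner_commute)
  qed
  then show ?thesis
    using summable_sums[OF sm] unfolding w_def c_def by simp
qed

theorem proposition3p7:
  fixes \<Omega> :: "'a::euclidean_space set"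
    and lam :: "nat \<Rightarrow> real"
    and e :: "nat \<Rightarrow> 'a l2"
    and P :: "real poly"
    and u0 :: "'a l2"
    and u :: "real \<Rightarrow> 'a l2"
  assumes "smooth_bounded_domain \<Omega>"
    and "dirichlet_eigenbasis \<Omega> lam e"
    and "degree P \<ge> 1" and "lead_coeff P > 0"
    and "u0 \<in> unit_sphere \<Omega>"
    and "flow_solution \<Omega> P lam e u0 u"
  shows
    "(\<forall>j. \<forall>t\<ge>0. u t \<bullet> e j =
        exp (- poly P (lam j) * t) * (u0 \<bullet> e j) /
        sqrt (\<Sum>k. exp (- 2 * poly P (lam k) * t) * \<bar>u0 \<bullet> e k\<bar>\<^sup>2)) \<and>
     (\<forall>j. \<forall>t\<ge>0. u t \<bullet> e j = 0 \<longleftrightarrow> u0 \<bullet> e j = 0) \<and>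
     (\<forall>t\<ge>0. active_spectrum P lam e (u t) = active_spectrum P lam e u0) \<and>
     (\<forall>\<mu>\<in>poly_spectrum \<Omega> P lam e. \<forall>t\<ge>0.
        eigenproj \<Omega> P lam e \<mu> (u t) =
        (exp (- \<mu> * t) / norm (semigroup_op P lam e t u0)) *\<^sub>R eigenproj \<Omega> P lam e \<mu> u0)"
proof -
  let ?p = "\<lambda>j. poly P (lam j)"
  define N where "N t = norm (semigroup_op P lam e t u0)" for t
  have basis: "hilbert_basis e" and L2: "closure (span (range e)) = L2_on \<Omega>"
    using assms(2) by (auto simp: dirichlet_eigenbasis_def hilbert_basis_def)
  interpret hilbert_basis e
    by (rule basis)
  have u_H: "u t \<in> H" and u_unit: "norm (u t) = 1" if "t \<ge> 0" for t
    using assms(6) that by (auto simp: flow_solution_def unit_sphere_def L2)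
  \<comment> \<open>The factor \<open>L\<close> is identified by computing the norm of \<open>S\<^sub>P(t)u\<^sub>0 = L u(t)\<close> in two ways.\<close>
  have key: "N t > 0 \<and> (\<forall>j. u t \<bullet> e j = exp (- ?p j * t) * (u0 \<bullet> e j) / N t) \<and>
      N t = sqrt (\<Sum>k. exp (- 2 * ?p k * t) * \<bar>u0 \<bullet> e k\<bar>\<^sup>2)" if t: "t \<ge> 0" for t
  proof -
    obtain L where L: "L > 0" and co: "\<And>j. u t \<bullet> e j = exp (- ?p j * t) * (u0 \<bullet> e j) / L"
      using flow_solution_coefficients[OF basis L2 assms(6) t] by blast
    have S: "exp (- ?p j * t) * (u0 \<bullet> e j) = L * (u t \<bullet> e j)" for j
      using L by (simp add: co)
    have "(\<lambda>j. L *\<^sub>R ((u t \<bullet> e j) *\<^sub>R e j)) sums (L *\<^sub>R u t)"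
      by (intro sums_scaleR_right expansion u_H t)
    then have "semigroup_op P lam e t u0 = L *\<^sub>R u t"
      using S by (simp add: semigroup_op_def sums_iff mult.commute)
    then have NL: "N t = L"
      using L by (simp add: N_def u_unit[OF t])
    have "exp (- 2 * ?p k * t) * \<bar>u0 \<bullet> e k\<bar>\<^sup>2 = L\<^sup>2 * ((u t \<bullet> e k) * (u t \<bullet> e k))" for k
    proof -
      have "exp (- 2 * ?p k * t) * \<bar>u0 \<bullet> e k\<bar>\<^sup>2 = (exp (- ?p k * t) * (u0 \<bullet> e k))\<^sup>2"
        by (simp add: power_mult_distrib flip: exp_double)
      then show ?thesis
        unfolding S by (simp add: power2_eq_square)
    qed
    moreover have "(\<lambda>k. L\<^sup>2 * ((u t \<bullet> e k) * (u t \<bullet> e k))) sums (L\<^sup>2 * (u t \<bullet> u t))"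
      by (intro sums_mult parseval u_H t)
    ultimately have "(\<Sum>k. exp (- 2 * ?p k * t) * \<bar>u0 \<bullet> e k\<bar>\<^sup>2) = L\<^sup>2"
      using u_unit[OF t] by (simp add: sums_iff norm_eq_1)
    then show ?thesis
      using L co NL by simp
  qed
  then have N_pos: "N t > 0"
    and coeff: "u t \<bullet> e j = exp (- ?p j * t) * (u0 \<bullet> e j) / N t"
    and N_eq: "N t = sqrt (\<Sum>k. exp (- 2 * ?p k * t) * \<bar>u0 \<bullet> e k\<bar>\<^sup>2)"
    if "t \<ge> 0" for t j
    using that by blast+
  have zero: "u t \<bullet> e j = 0 \<longleftrightarrow> u0 \<bullet> e j = 0" if "t \<ge> 0" for t j
    using N_pos[OF that] by (simp add: coeff[OF that])
  have proj: "eigenproj \<Omega> P lam e \<mu> (u t) = (exp (- \<mu> * t) / N t) *\<^sub>R eigenproj \<Omega> P lam e \<mu> u0"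
    if t: "t \<ge> 0" for \<mu> t
  proof -
    have "u t \<in> L2_on \<Omega>" "u0 \<in> L2_on \<Omega>"
      using u_H[OF t] assms(5) by (simp_all add: L2 unit_sphere_def)
    note sums = this[THEN eigenproj_sums[OF basis L2, where P = P and lam = lam and \<mu> = \<mu>]]
    have "(if ?p j = \<mu> then u t \<bullet> e j else 0) *\<^sub>R e j =
        (exp (- \<mu> * t) / N t) *\<^sub>R ((if ?p j = \<mu> then u0 \<bullet> e j else 0) *\<^sub>R e j)" for j
      by (simp add: coeff[OF t])
    then show ?thesis
      using sums_unique2[OF sums(1)] sums_scaleR_right[OF sums(2), of "exp (- \<mu> * t) / N t"]
      by presburger
  qed
  show ?thesis
  proof (intro conjI allI ballI impI)
    fix j and t :: real
    assume "t \<ge> 0"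
    then show "u t \<bullet> e j = exp (- ?p j * t) * (u0 \<bullet> e j) /
        sqrt (\<Sum>k. exp (- 2 * ?p k * t) * \<bar>u0 \<bullet> e k\<bar>\<^sup>2)"
      using coeff[of t j] N_eq[of t] by simp
  qed (use zero proj in \<open>simp_all add: active_spectrum_def N_def\<close>)
qed

end
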